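(* Let $E$ be a Banach space and let $X$ be an $E$-valued random element whose law $\mu$ is a centered Gaussian measure with $\mu(A)>0$ for every non-empty open set $A\subset E$. Let $V:E\to\mathbb R$ be a Borel measurable mapping that is differentiable and non-constant on some connected open subset of $E$. Then the law of the random variable $V(X)$ and the Lebesgue measure on $\mathbb R$ are not mutually singular.
   Context: Differentiability is in the Fréchet sense: $V(f+g)=V(f)+\langle d_fV,g\rangle+o(\|g\|)$ as $g\to0$ in $E$, with $d_fV\in E^*$. *)

theory Defs
  imports "HOL-Probability.Probability"
begin

text \<open>
  The case \<open>\<sigma> = 0\<close> (point mass at 0) is split off because
  \<^term>\<open>normal_density 0 0\<close> is identically zero (division by zero), not the degenerate
  Gaussian law. It cannot be dropped: already \<open>f = 0\<close> pushes every law forward to the point mass.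
\<close>

definition centered_gaussian_real :: "real measure \<Rightarrow> bool" where
  "centered_gaussian_real \<nu> \<longleftrightarrow>
     (\<exists>\<sigma>\<ge>0. \<nu> = (if \<sigma> = 0 then return borel 0
                  else density lborel (\<lambda>x. ennreal (normal_density 0 \<sigma> x))))"

definition centered_gaussian_measure :: "'a::real_normed_vector measure \<Rightarrow> bool" where
  "centered_gaussian_measure \<mu> \<longleftrightarrow>
     prob_space \<mu> \<and> sets \<mu> = sets borel \<and>
     (\<forall>f::'a \<Rightarrow> real. bounded_linear f \<longrightarrow> centered_gaussian_real (distr \<mu> borel f))"

text \<open>Meant for two measures on the same measurable space.\<close>

definition mutually_singular :: "'a measure \<Rightarrow> 'a measure \<Rightarrow> bool" where
  "mutually_singular M N \<longleftrightarrow>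
     (\<exists>A \<in> sets M \<inter> sets N. emeasure M A = 0 \<and> emeasure N (space N - A) = 0)"

end

theory Submission
  imports Defs
begin

text \<open>
  Let \<open>X'\<close> be an independent copy of \<open>X\<close>. Each \<open>cos t X + sin t X'\<close> has law \<open>\<mu>\<close>, so if \<open>V(X)\<close> almost
  surely lies in a Lebesgue null set \<open>B\<close>, then by Fubini almost every pair \<open>(X, X')\<close> satisfies
  \<open>V(cos t X + sin t X') \<in> B\<close> for almost every \<open>t\<close>. On a time interval whose arc stays in \<open>U\<close> this
  differentiable function of \<open>t\<close> has a connected null image, hence is constant. The support of \<open>\<mu>\<close>
  being full, continuity of \<open>V\<close> extends the constancy to all short arcs \<open>cos t x + sin t y\<close> issuing
  from points \<open>x \<in> U\<close>; differentiating at \<open>t = 0\<close> gives \<open>d\<^sub>xV(y) = 0\<close> for all \<open>y\<close>, so \<open>V\<close> is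
  constant on \<open>U\<close>.

  The rotation invariance is read off the characteristic functionals. These determine the measure
  because a full support forces separability, so that half-spaces generate the Borel sets.
\<close>

subsection \<open>Norming functionals\<close>

text \<open>Homogeneity is stated as an inequality only, the form that passes directly to infima;
  equality returns by applying it with the factor \<open>1/c\<close>.\<close>

definition sublinear :: "('a::real_vector \<Rightarrow> real) \<Rightarrow> bool" where
  "sublinear q \<longleftrightarrow> (\<forall>x y. q (x + y) \<le> q x + q y) \<and> (\<forall>c>0. \<forall>x. q (c *\<^sub>R x) \<le> c * q x)"

lemma sublinear_add: "sublinear q \<Longrightarrow> q (x + y) \<le> q x + q y"
  and sublinear_scale_le: "sublinear q \<Longrightarrow> 0 < c \<Longrightarrow> q (c *\<^sub>R x) \<le> c * q x"
  by (auto simp: sublinear_def)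

lemma sublinear_scale:
  assumes "sublinear q" "0 < c"
  shows "q (c *\<^sub>R x) = c * q x"
proof (rule antisym)
  show "q (c *\<^sub>R x) \<le> c * q x" using assms by (rule sublinear_scale_le)
  have "q ((1/c) *\<^sub>R (c *\<^sub>R x)) \<le> (1/c) * q (c *\<^sub>R x)"
    using assms by (intro sublinear_scale_le) auto
  then show "c * q x \<le> q (c *\<^sub>R x)" using assms(2) by (simp add: field_simps)
qed

lemma sublinear_0: "sublinear q \<Longrightarrow> q 0 = 0"
  using sublinear_scale[of q 2 0] by simp

lemma sublinear_ge: "sublinear q \<Longrightarrow> - q (- x) \<le> q x"
  using sublinear_add[of q x "- x"] sublinear_0[of q] by simp

text \<open>For sublinear \<open>q\<close> this is the largest sublinear functional
  \<open>r \<le> q\<close> with \<open>r (- y) \<le> - q y\<close>. A linear functional below it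
  therefore agrees with \<open>q\<close> at \<open>y\<close>.\<close>

definition tilt :: "('a::real_vector \<Rightarrow> real) \<Rightarrow> 'a \<Rightarrow> 'a \<Rightarrow> real" where
  "tilt q y x = (INF t\<in>{0..}. q (x + t *\<^sub>R y) - t * q y)"

lemma tilt_le:
  assumes "sublinear q" "0 \<le> t"
  shows "tilt q y x \<le> q (x + t *\<^sub>R y) - t * q y"
  unfolding tilt_def
proof (rule cINF_lower)
  \<comment> \<open>The bound comes from \<open>t * q y = q (t *\<^sub>R y) \<le> q (x + t *\<^sub>R
    y) + q (- x)\<close>; a real \<open>INF\<close> is a lower bound only for families bounded
    below.\<close>
  have "- q (- x) \<le> q (x + t *\<^sub>R y) - t * q y" if "t \<ge> 0" for t
  proof -
    have "t * q y = q (t *\<^sub>R y)"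
      using that sublinear_scale[OF assms(1), of t y] sublinear_0[OF assms(1)]
      by (cases "t = 0") auto
    then show ?thesis
      using sublinear_add[OF assms(1), of "x + t *\<^sub>R y" "- x"] by simp
  qed
  then show "bdd_below ((\<lambda>t. q (x + t *\<^sub>R y) - t * q y) ` {0..})"
    by (intro bdd_belowI2[where m = "- q (- x)"]) auto
qed (use assms in auto)

lemma tilt_greatest:
  assumes "\<And>t. 0 \<le> t \<Longrightarrow> c \<le> q (x + t *\<^sub>R y) - t * q y"
  shows "c \<le> tilt q y x"
  unfolding tilt_def using assms by (intro cINF_greatest) auto

lemma tilt_le_self: "sublinear q \<Longrightarrow> tilt q y x \<le> q x"
  using tilt_le[of q 0 y x] by simp

lemma tilt_minus_le: "sublinear q \<Longrightarrow> tilt q y (- y) \<le> - q y"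
  using tilt_le[of q 1 y "- y"] sublinear_0[of q] by simp

text \<open>A parameter \<open>s\<close> for \<open>x1\<close> and \<open>t\<close> for
  \<open>x2\<close> combine to \<open>s + t\<close> for the sum, and \<open>t\<close> for
  \<open>x\<close> becomes \<open>c * t\<close> for the scaled vector. The infima are taken one
  parameter at a time.\<close>

lemma sublinear_tilt:
  assumes q: "sublinear q"
  shows "sublinear (tilt q y)"
  unfolding sublinear_def
proof safe
  fix x1 x2
  have "tilt q y (x1 + x2) - (q (x1 + s *\<^sub>R y) - s * q y) \<le> tilt q y x2" if s: "0 \<le> s" for s
  proof (rule tilt_greatest)
    fix t :: real assume t: "0 \<le> t"
    have "tilt q y (x1 + x2) \<le> q ((x1 + x2) + (s + t) *\<^sub>R y) - (s + t) * q y"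
      using s t by (intro tilt_le q) auto
    moreover have "q ((x1 + x2) + (s + t) *\<^sub>R y) \<le> q (x1 + s *\<^sub>R y) + q (x2 + t *\<^sub>R y)"
      using sublinear_add[OF q, of "x1 + s *\<^sub>R y" "x2 + t *\<^sub>R y"] by (simp add: algebra_simps)
    ultimately show "tilt q y (x1 + x2) - (q (x1 + s *\<^sub>R y) - s * q y) \<le> q (x2 + t *\<^sub>R y) - t * q y"
      by (simp add: algebra_simps)
  qed
  then have "tilt q y (x1 + x2) - tilt q y x2 \<le> tilt q y x1"
    by (intro tilt_greatest) (simp add: algebra_simps)
  then show "tilt q y (x1 + x2) \<le> tilt q y x1 + tilt q y x2" by simp
next
  fix c :: real and x assume c: "0 < c"
  have "tilt q y (c *\<^sub>R x) / c \<le> tilt q y x"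
  proof (rule tilt_greatest)
    fix t :: real assume t: "0 \<le> t"
    have "tilt q y (c *\<^sub>R x) \<le> q (c *\<^sub>R x + (c * t) *\<^sub>R y) - (c * t) * q y"
      using c t by (intro tilt_le q) auto
    also have "\<dots> = c * (q (x + t *\<^sub>R y) - t * q y)"
      using sublinear_scale[OF q c, of "x + t *\<^sub>R y"] by (simp add: algebra_simps)
    finally show "tilt q y (c *\<^sub>R x) / c \<le> q (x + t *\<^sub>R y) - t * q y"
      using c by (simp add: field_simps)
  qed
  then show "tilt q y (c *\<^sub>R x) \<le> c * tilt q y x" using c by (simp add: field_simps)
qed

text \<open>Subadditivity survives the infimum because the smaller of two members of a chain lies
  below both: \<open>s (x + y) \<le> s x + s y \<le> q x + r y\<close>.\<close>

lemma sublinear_chain_Inf: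
  assumes C: "C \<noteq> {}" "\<And>q. q \<in> C \<Longrightarrow> sublinear q"
    and bdd: "\<And>x. bdd_below ((\<lambda>q. q x) ` C)"
    and chain: "\<And>q r. q \<in> C \<Longrightarrow> r \<in> C \<Longrightarrow> q \<le> r \<or> r \<le> q"
  shows "sublinear (\<lambda>x. INF q\<in>C. q x)"
  unfolding sublinear_def
proof safe
  let ?u = "\<lambda>x. INF q\<in>C. q x"
  have low: "?u x \<le> q x" if "q \<in> C" for q x
    using that bdd by (intro cINF_lower)
  fix x y
  have *: "?u (x + y) \<le> q x + r y" if qr: "q \<in> C" "r \<in> C" for q r
  proof -
    obtain s where s: "s \<in> C" "s \<le> q" "s \<le> r" using chain[OF qr] qr by auto
    have "?u (x + y) \<le> s (x + y)" using s by (intro low)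
    also have "\<dots> \<le> s x + s y" using s C by (intro sublinear_add) auto
    also have "\<dots> \<le> q x + r y" using s by (intro add_mono) (auto simp: le_fun_def)
    finally show ?thesis .
  qed
  have "?u (x + y) - q x \<le> ?u y" if "q \<in> C" for q
    using C *[OF that] by (intro cINF_greatest) (auto simp: algebra_simps)
  then have "?u (x + y) - ?u y \<le> ?u x"
    using C by (intro cINF_greatest) (auto simp: algebra_simps)
  then show "?u (x + y) \<le> ?u x + ?u y" by simp
next
  let ?u = "\<lambda>x. INF q\<in>C. q x"
  fix c :: real and x assume c: "0 < c"
  have "?u (c *\<^sub>R x) / c \<le> ?u x"
  proof (intro cINF_greatest C)
    fix q assume q: "q \<in> C"
    have "?u (c *\<^sub>R x) \<le> q (c *\<^sub>R x)" using q bdd by (intro cINF_lower)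
    also have "\<dots> \<le> c * q x" using q C c by (intro sublinear_scale_le) auto
    finally show "?u (c *\<^sub>R x) / c \<le> q x" using c by (simp add: field_simps)
  qed
  then show "?u (c *\<^sub>R x) \<le> c * ?u x" using c by (simp add: field_simps)
qed

text \<open>A minimal sublinear functional is fixed by every \<^const>\<open>tilt\<close>, hence odd, hence linear.\<close>

lemma linear_below_sublinear:
  fixes p :: "'a::real_vector \<Rightarrow> real"
  assumes p: "sublinear p"
  shows "\<exists>f. linear f \<and> f \<le> p"
proof -
  define A where "A = {q. sublinear q \<and> q \<le> p}"
  \<comment> \<open>Zorn's lemma is used in the reversed order, so that its maximal element is a
    minimal functional; a non-empty chain is bounded by its pointwise infimum.\<close>
  have "\<exists>m\<in>A. \<forall>q\<in>A. q \<le> m \<longrightarrow> q = m"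
  proof (rule predicate_Zorn[where P = "\<lambda>a b. b \<le> a"])
    show "partial_order_on A (relation_of (\<lambda>a b. b \<le> a) A)"
      by (rule partial_order_on_relation_ofI) auto
    fix C assume C: "C \<in> Chains (relation_of (\<lambda>a b. b \<le> a) A)"
    then have CA: "C \<subseteq> A" and chain: "\<And>q r. q \<in> C \<Longrightarrow> r \<in> C \<Longrightarrow> q \<le> r \<or> r \<le> q"
      unfolding Chains_def relation_of_def by auto
    show "\<exists>u\<in>A. \<forall>a\<in>C. u \<le> a"
    proof (cases "C = {}")
      case True
      then show ?thesis using p by (auto simp: A_def)
    next
      case False
      have bdd: "bdd_below ((\<lambda>q. q x) ` C)" for x
      proof (rule bdd_belowI2)
        fix q assume "q \<in> C"
        then have "q (- x) \<le> p (- x)" "- q (- x) \<le> q x"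
          using CA sublinear_ge[of q x] by (auto simp: A_def le_fun_def)
        then show "- p (- x) \<le> q x" by linarith
      qed
      have low: "(\<lambda>x. INF q\<in>C. q x) \<le> r" if "r \<in> C" for r
        using that bdd by (auto simp: le_fun_def intro!: cINF_lower)
      have "sublinear (\<lambda>x. INF q\<in>C. q x)"
        using False CA bdd chain by (intro sublinear_chain_Inf) (auto simp: A_def)
      moreover have "(\<lambda>x. INF q\<in>C. q x) \<le> p"
        using False CA low by (fastforce simp: A_def)
      ultimately show ?thesis using low by (auto simp: A_def)
    qed
  qed
  then obtain m where m: "sublinear m" "m \<le> p" and min: "\<And>q. sublinear q \<Longrightarrow> q \<le> m \<Longrightarrow> q = m"
    by (auto simp: A_def intro: order_trans)
  have "tilt m y = m" for y
    using m by (intro min sublinear_tilt) (auto simp: le_fun_def intro: tilt_le_self)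
  then have odd: "m (- y) = - m y" for y
    using tilt_minus_le[OF m(1), of y] sublinear_ge[OF m(1), of y] sublinear_ge[OF m(1), of "- y"]
    by simp
  \<comment> \<open>By oddness, subadditivity at \<open>- x\<close> and \<open>- y\<close> is
    superadditivity at \<open>x\<close> and \<open>y\<close>.\<close>
  have add: "m (x + y) = m x + m y" for x y
    using sublinear_add[OF m(1), of x y] sublinear_add[OF m(1), of "- x" "- y"] odd[of "x + y"]
    by (simp add: odd)
  have "m (c *\<^sub>R x) = c * m x" for c x
  proof -
    consider "c > 0" | "c = 0" | "c < 0" by linarith
    then show ?thesis
    proof cases
      case 3
      then show ?thesis using sublinear_scale[OF m(1), of "- c" x] odd[of "c *\<^sub>R x"] by simp
    qed (use m sublinear_scale sublinear_0 in auto)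
  qed
  then have "linear m" by (intro linearI) (auto simp: add)
  then show ?thesis using m by auto
qed

text \<open>A linear functional below \<open>tilt norm x0\<close> is dominated by the norm, and its
  value at \<open>- x0\<close> is at most \<open>- norm x0\<close>; this forces equality at
  \<open>x0\<close>.\<close>

lemma norming_functional:
  fixes x0 :: "'a::real_normed_vector"
  shows "\<exists>f. bounded_linear f \<and> (\<forall>x. f x \<le> norm x) \<and> f x0 = norm x0"
proof -
  have norm: "sublinear (norm :: 'a \<Rightarrow> real)"
    by (auto simp: sublinear_def norm_triangle_ineq)
  obtain f where f: "linear f" "f \<le> tilt norm x0"
    using linear_below_sublinear[OF sublinear_tilt[OF norm]] by blast
  have le: "f x \<le> norm x" for x
    using f(2) tilt_le_self[OF norm, of x0 x] by (meson le_fun_def order_trans)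
  have "f (- x0) \<le> - norm x0"
    using f(2) tilt_minus_le[OF norm, of x0] by (meson le_fun_def order_trans)
  then have "f x0 = norm x0"
    using le[of x0] f(1) by (simp add: linear_neg)
  moreover have "bounded_linear f"
  proof (rule bounded_linear_intro[where K = 1])
    show "norm (f x) \<le> norm x * 1" for x
      using le[of x] le[of "- x"] f(1) by (simp add: linear_neg abs_le_iff)
  qed (auto simp: f linear_add linear_cmul)
  ultimately show ?thesis using le by blast
qed

subsection \<open>Borel sets of separable spaces\<close>

lemma countable_if_sum_bounded:
  fixes f :: "'a \<Rightarrow> real"
  assumes pos: "\<And>x. x \<in> S \<Longrightarrow> 0 < f x"
    and bound: "\<And>F. finite F \<Longrightarrow> F \<subseteq> S \<Longrightarrow> sum f F \<le> B"
  shows "countable S"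
proof -
  have "f summable_on S"
    using pos bound
    by (intro nonneg_bdd_above_summable_on) (auto intro!: bdd_aboveI[where M = B] simp: less_imp_le)
  then have "countable {x \<in> S. f x \<noteq> 0}" by (rule summable_countable_real)
  moreover have "{x \<in> S. f x \<noteq> 0} = S" using pos by force
  ultimately show ?thesis by simp
qed

text \<open>Zorn's lemma gives a maximal \<open>e\<close>-separated set. A point at distance at
  least \<open>e\<close> from all of it could be added, so the set is also an
  \<open>e\<close>-net.\<close>

lemma ex_maximal_separated:
  assumes e: "0 < e"
  shows "\<exists>S :: 'a::metric_space set. (\<forall>x\<in>S. \<forall>y\<in>S. x \<noteq> y \<longrightarrow> e \<le> dist x y) \<and>
           (\<forall>x. \<exists>y\<in>S. dist x y < e)"
proof -
  let ?A = "{S :: 'a set. \<forall>x\<in>S. \<forall>y\<in>S. x \<noteq> y \<longrightarrow> e \<le> dist x y}"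
  have "\<exists>M\<in>?A. \<forall>S\<in>?A. M \<subseteq> S \<longrightarrow> S = M"
  proof (rule subset_Zorn')
    fix C assume C: "subset.chain ?A C"
    show "\<Union>C \<in> ?A"
    proof safe
      fix x y S T assume xy: "x \<in> S" "S \<in> C" "y \<in> T" "T \<in> C" "x \<noteq> y"
      then have "S \<subseteq> T \<or> T \<subseteq> S"
        using C unfolding subset_chain_def by blast
      moreover have "S \<in> ?A" "T \<in> ?A"
        using xy C unfolding subset_chain_def by blast+
      ultimately show "e \<le> dist x y" using xy by blast
    qed
  qed
  then obtain M where M: "M \<in> ?A" and max: "\<forall>S\<in>?A. M \<subseteq> S \<longrightarrow> S = M" by (rule bexE)
  have "\<exists>y\<in>M. dist x y < e" for x
  proof (rule ccontr)
    assume neg: "\<not> (\<exists>y\<in>M. dist x y < e)"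
    then have "insert x M \<in> ?A" using M by (auto simp: not_less dist_commute)
    then have "insert x M = M" by (rule max[rule_format]) auto
    then show False using neg e by (metis dist_self insertI1)
  qed
  then show ?thesis using M by (intro exI[of _ M]) simp
qed

text \<open>Balls of radius \<open>e/2\<close> around an \<open>e\<close>-separated set are disjoint
  and have positive mass, while the total mass is finite, so such a set is countable. The union of
  countable nets for \<open>e = 1 / Suc n\<close> is dense.\<close>

lemma separable_if_full_support:
  fixes \<mu> :: "'a::metric_space measure"
  assumes fin: "finite_measure \<mu>" and sets: "sets \<mu> = sets borel"
    and pos: "\<And>A. open A \<Longrightarrow> A \<noteq> {} \<Longrightarrow> emeasure \<mu> A > 0"
  shows "\<exists>D. countable D \<and> closure D = (UNIV :: 'a set)"
proof -
  interpret finite_measure \<mu> by fact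
  have "\<exists>S :: 'a set. countable S \<and> (\<forall>x. \<exists>y\<in>S. dist x y < e)" if e: "0 < e" for e
  proof -
    obtain S :: "'a set" where sep: "\<forall>x\<in>S. \<forall>y\<in>S. x \<noteq> y \<longrightarrow> e \<le> dist x y"
      and net: "\<forall>x. \<exists>y\<in>S. dist x y < e"
      using ex_maximal_separated[OF e, where 'a = 'a] by (elim exE conjE)
    have "countable S"
    proof (rule countable_if_sum_bounded)
      fix x
      have "emeasure \<mu> (ball x (e/2)) > 0" using e by (intro pos) auto
      then show "0 < measure \<mu> (ball x (e/2))"
        by (simp add: emeasure_eq_measure)
    next
      fix F assume F: "finite F" "F \<subseteq> S"
      have "disjoint_family_on (\<lambda>x. ball x (e/2)) F"
        unfolding disjoint_family_on_def
      proof safe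
        fix x y z assume xy: "x \<in> F" "y \<in> F" "x \<noteq> y" and z: "z \<in> ball x (e/2)" "z \<in> ball y (e/2)"
        have "dist x y < e" using z by (intro dist_triangle_half_l[of x z e y]) (auto simp: dist_commute)
        then show "z \<in> {}" using sep xy F by force
      qed
      then have "(\<Sum>x\<in>F. measure \<mu> (ball x (e/2))) = measure \<mu> (\<Union>x\<in>F. ball x (e/2))"
        using F by (intro finite_measure_finite_Union[symmetric]) (auto simp: sets)
      also have "\<dots> \<le> measure \<mu> (space \<mu>)" by (rule bounded_measure)
      finally show "(\<Sum>x\<in>F. measure \<mu> (ball x (e/2))) \<le> measure \<mu> (space \<mu>)" .
    qed
    then show ?thesis using net by blast
  qed
  then have "\<forall>n. \<exists>S :: 'a set. countable S \<and> (\<forall>x. \<exists>y\<in>S. dist x y < 1 / Suc n)"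
    by simp
  then obtain S :: "nat \<Rightarrow> 'a set"
    where S: "\<And>n. countable (S n)" "\<And>n x. \<exists>y\<in>S n. dist x y < 1 / Suc n"
    by metis
  have "x \<in> closure (\<Union>n. S n)" for x
    unfolding closure_approachable
  proof safe
    fix e :: real assume "0 < e"
    then obtain n where "1 / Suc n < e" by (metis nat_approx_posE)
    moreover obtain y where "y \<in> S n" "dist x y < 1 / Suc n" using S(2) by blast
    ultimately show "\<exists>y\<in>(\<Union>n. S n). dist y x < e"
      by (intro bexI[of _ y]) (auto simp: dist_commute)
  qed
  then show ?thesis using S(1) by (intro exI[of _ "\<Union>n. S n"]) auto
qed

section \<open>Countable bases and the Borel sets of a product\<close>

lemma topological_basis_dense_balls:
  assumes D: "closure D = (UNIV :: 'a::metric_space set)"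
  shows "topological_basis ((\<lambda>(d, n). ball d (1 / Suc n)) ` (D \<times> UNIV))"
proof (rule topological_basisI)
  fix O' :: "'a set" and x assume "open O'" "x \<in> O'"
  then obtain e where e: "0 < e" "ball x e \<subseteq> O'" by (meson openE)
  obtain n where n: "1 / Suc n < e / 2" by (metis half_gt_zero nat_approx_posE e(1))
  have "x \<in> closure D" using D by simp
  then obtain d where d: "d \<in> D" "dist d x < 1 / Suc n"
    unfolding closure_approachable by (meson of_nat_0_less_iff zero_less_Suc zero_less_divide_1_iff)
  have "y \<in> ball x e" if "y \<in> ball d (1 / Suc n)" for y
  proof -
    have "dist x y \<le> dist d x + dist d y" by (metis dist_commute dist_triangle)
    then show ?thesis using n d that by auto
  qed
  then show "\<exists>B'\<in>(\<lambda>(d, n). ball d (1 / Suc n)) ` (D \<times> UNIV). x \<in> B' \<and> B' \<subseteq> O'"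
    using d e by (intro bexI[of _ "ball d (1 / Suc n)"]) auto
qed auto

text \<open>The products of balls around dense points form a countable basis of measurable
  rectangles, so open sets are product measurable. The other inclusion is measurability of the
  projections. Separability is expressed by dense sets and not by a type class because it is derived
  from the measure.\<close>

lemma sets_borel_Times_separable:
  assumes A: "countable C" "closure C = (UNIV :: 'a::metric_space set)"
    and B: "countable D" "closure D = (UNIV :: 'b::metric_space set)"
  shows "sets ((borel :: 'a measure) \<Otimes>\<^sub>M (borel :: 'b measure)) = sets borel"
proof (rule antisym)
  define P where "P = (\<lambda>(a, b). a \<times> b) ` (((\<lambda>(d, n). ball d (1 / Suc n)) ` (C \<times> (UNIV :: nat set)))
      \<times> ((\<lambda>(d, n). ball d (1 / Suc n)) ` (D \<times> (UNIV :: nat set))))"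
  have "topological_basis P"
    unfolding P_def by (intro topological_basis_prod topological_basis_dense_balls A B)
  moreover have "countable P" unfolding P_def using A B by (intro countable_image countable_SIGMA) auto
  ultimately have "sets (borel :: ('a \<times> 'b) measure) = sigma_sets UNIV P"
    by (metis borel_eq_countable_basis Pow_UNIV sets_measure_of subset_UNIV)
  moreover have "P \<subseteq> sets ((borel :: 'a measure) \<Otimes>\<^sub>M (borel :: 'b measure))"
    unfolding P_def by (auto intro!: pair_measureI)
  ultimately show "sets borel \<subseteq> sets ((borel :: 'a measure) \<Otimes>\<^sub>M (borel :: 'b measure))"
    using sets.sigma_sets_subset[of P "(borel :: 'a measure) \<Otimes>\<^sub>M (borel :: 'b measure)"]
    by (simp add: space_pair_measure)
  have "a \<times> b \<in> sets borel" if ab: "a \<in> sets borel" "b \<in> sets borel" for a :: "'a set" and b :: "'b set"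
  proof -
    have "fst -` a \<inter> space borel \<in> sets (borel :: ('a \<times> 'b) measure)"
      using ab by (intro measurable_sets[of fst borel borel]
          borel_measurable_continuous_onI continuous_intros)
    moreover have "snd -` b \<inter> space borel \<in> sets (borel :: ('a \<times> 'b) measure)"
      using ab by (intro measurable_sets[of snd borel borel]
          borel_measurable_continuous_onI continuous_intros)
    moreover have "a \<times> b = (fst -` a \<inter> space borel) \<inter> (snd -` b \<inter> space borel)" by auto
    ultimately show "a \<times> b \<in> sets borel" by simp
  qed
  then have "{a \<times> b |a b. a \<in> sets borel \<and> b \<in> sets borel} \<subseteq> sets (borel :: ('a \<times> 'b) measure)"
    by blast
  from sets.sigma_sets_subset[OF this]
  show "sets ((borel :: 'a measure) \<Otimes>\<^sub>M (borel :: 'b measure)) \<subseteq> sets borel"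
    unfolding sets_pair_measure by simp
qed

text \<open>Finite intersections of sets \<open>f x \<le> a\<close>, built up one at a time: an
  equality of characters can then be carried along by adding a single half-space in each
  step.\<close>

inductive_set cylinder_sets :: "'a::real_normed_vector set set" where
  UNIV: "UNIV \<in> cylinder_sets"
| halfspace: "C \<in> cylinder_sets \<Longrightarrow> bounded_linear f \<Longrightarrow> C \<inter> {x. f x \<le> (a :: real)} \<in> cylinder_sets"

lemma Int_stable_cylinder_sets: "Int_stable cylinder_sets"
proof (rule Int_stableI)
  fix A B :: "'a set"
  assume A: "A \<in> cylinder_sets"
  assume "B \<in> cylinder_sets"
  then show "A \<inter> B \<in> cylinder_sets"
  proof induction
    case (halfspace C f a)
    then have "(A \<inter> C) \<inter> {x. f x \<le> a} \<in> cylinder_sets" by (intro cylinder_sets.intros)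
    then show ?case by (simp add: Int_assoc)
  qed (simp add: A)
qed

lemma borel_measurable_bounded_linear:
  fixes f :: "'a::real_normed_vector \<Rightarrow> 'b::real_normed_vector"
  shows "bounded_linear f \<Longrightarrow> f \<in> borel_measurable borel"
  by (intro borel_measurable_continuous_onI linear_continuous_on)

lemma sets_borel_halfspace:
  fixes f :: "'a::real_normed_vector \<Rightarrow> real"
  shows "bounded_linear f \<Longrightarrow> {x. f x \<le> a} \<in> sets borel"
  using borel_measurable_bounded_linear[of f] by measurable

lemma cylinder_sets_borel: "C \<in> cylinder_sets \<Longrightarrow> C \<in> sets borel"
  by (induction rule: cylinder_sets.induct) (auto intro: sets_borel_halfspace)

text \<open>Norming functionals of the countably many points of \<open>D\<close> compute the norm
  everywhere, so a closed ball is a countable intersection of half-spaces. Open balls are countable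
  unions of closed ones and contain a countable basis.\<close>

lemma sigma_sets_cylinder_sets:
  assumes D: "countable D" "closure D = (UNIV :: 'a::real_normed_vector set)"
  shows "sigma_sets UNIV cylinder_sets = sets (borel :: 'a measure)"
proof (rule antisym)
  show "sigma_sets UNIV cylinder_sets \<subseteq> sets (borel :: 'a measure)"
    using sets.sigma_sets_subset[of cylinder_sets "borel :: 'a measure"] cylinder_sets_borel by auto
next
  obtain F :: "'a \<Rightarrow> 'a \<Rightarrow> real" where F: "\<And>k. bounded_linear (F k)"
    "\<And>k x. F k x \<le> norm x" "\<And>k. F k k = norm k"
    using norming_functional by metis
  \<comment> \<open>For \<open>k\<close> close to \<open>x\<close>, the functional
    \<open>F k\<close> almost norms \<open>x\<close>:
    \<open>norm x \<le> F k x + 2 * norm (k - x)\<close>.\<close>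
  have norm_le_iff: "norm x \<le> c \<longleftrightarrow> (\<forall>k\<in>D. F k x \<le> c)" for x c
  proof safe
    assume *: "\<forall>k\<in>D. F k x \<le> c"
    show "norm x \<le> c"
    proof (rule field_le_epsilon)
      fix e :: real assume "0 < e"
      moreover have "x \<in> closure D" using D by simp
      ultimately obtain k where k: "k \<in> D" "dist k x < e / 2"
        unfolding closure_approachable by (meson half_gt_zero)
      have "F k k = F k x + F k (k - x)"
        using F(1)[of k] by (simp add: linear_diff bounded_linear.linear)
      moreover have "norm x \<le> norm k + norm (k - x)"
        by (metis norm_minus_commute norm_triangle_sub)
      ultimately have "norm x \<le> F k x + 2 * norm (k - x)"
        using F(2)[of k "k - x"] F(3)[of k] by simp
      then show "norm x \<le> c + e" using k * by (force simp: dist_norm)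
    qed
  qed (use F(2) order_trans in blast)
  interpret S: sigma_algebra UNIV "sigma_sets UNIV (cylinder_sets :: 'a set set)"
    by (rule sigma_algebra_sigma_sets) simp
  have half: "{x. F k x \<le> a} \<in> sigma_sets UNIV cylinder_sets" for k a
    using cylinder_sets.halfspace[OF cylinder_sets.UNIV F(1)[of k], of a] by auto
  have "cball d r \<in> sigma_sets UNIV cylinder_sets" for d :: 'a and r
  proof -
    have "norm (x - d) \<le> r \<longleftrightarrow> (\<forall>k\<in>D. F k x \<le> r + F k d)" for x
      unfolding norm_le_iff using F(1) by (simp add: linear_diff bounded_linear.linear algebra_simps)
    then have "cball d r = (\<Inter>k\<in>D. {x. F k x \<le> r + F k d})"
      by (auto simp: dist_norm norm_minus_commute)
    moreover have "D \<noteq> {}" using D by auto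
    ultimately show ?thesis using D half by (auto intro!: S.countable_INT')
  qed
  moreover have "ball d r = (\<Union>n::nat. cball d (r - 1 / Suc n))" for d :: 'a and r
  proof safe
    fix x assume "x \<in> ball d r"
    then have "0 < r - dist d x" by simp
    then obtain n where "1 / Suc n < r - dist d x" by (metis nat_approx_posE)
    then show "x \<in> (\<Union>n::nat. cball d (r - 1 / Suc n))" by (intro UN_I[of n]) auto
  next
    fix x and n :: nat assume "x \<in> cball d (r - 1 / Suc n)"
    moreover have "0 < 1 / real (Suc n)" by simp
    ultimately show "x \<in> ball d r" unfolding mem_cball mem_ball by linarith
  qed
  ultimately have ball: "ball d r \<in> sigma_sets UNIV cylinder_sets" for d :: 'a and r
    by (auto intro!: S.countable_UN)
  show "sets (borel :: 'a measure) \<subseteq> sigma_sets UNIV cylinder_sets"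
    using D ball
    by (subst borel_eq_countable_basis[OF _ topological_basis_dense_balls[OF D(2)]])
       (auto intro!: S.sigma_sets_subset)
qed

subsection \<open>Uniqueness of the characteristic functional\<close>

text \<open>The total masses agree, being the values of \<open>char\<close> at \<open>0\<close>.
  Division by this common mass \<open>c\<close> reduces the claim to \<open>Levy_uniqueness\<close>
  for probability measures; \<open>c = 0\<close> is treated apart.\<close>

lemma finite_measure_eq_if_char_eq:
  fixes M N :: "real measure"
  assumes M: "finite_measure M" "sets M = sets borel"
    and N: "finite_measure N" "sets N = sets borel"
    and char: "char M = char N"
  shows "M = N"
proof -
  interpret M: finite_measure M by (rule M)
  interpret N: finite_measure N by (rule N)
  have [simp]: "space M = UNIV" "space N = UNIV"
    using M N by (auto dest: sets_eq_imp_space_eq)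
  define c where "c = measure M UNIV"
  have c_N: "c = measure N UNIV"
    using fun_cong[OF char, of 0] by (simp add: char_def c_def)
  have sets_eq: "sets M = sets N" using M N by simp
  note [measurable_cong] = M(2) N(2)
  show ?thesis
  proof (cases "c = 0")
    case True
    then have "emeasure M UNIV = 0" "emeasure N UNIV = 0"
      using c_N by (auto simp: c_def M.emeasure_eq_measure N.emeasure_eq_measure)
    then have "emeasure M A = 0" "emeasure N A = 0" for A
      using emeasure_space[of M A] emeasure_space[of N A] by auto
    then show ?thesis using sets_eq by (intro measure_eqI) auto
  next
    case False
    then have c: "0 < c" unfolding c_def by (simp add: zero_less_measure_iff)
    have norm: "real_distribution (density K (\<lambda>_. ennreal (1 / c)))"
      "char (density K (\<lambda>_. ennreal (1 / c))) t = (1 / c) *\<^sub>R char K t"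
      if K: "finite_measure K" "sets K = sets borel" "measure K UNIV = c" for K t
    proof -
      interpret K: finite_measure K by (rule K)
      note [measurable_cong] = K(2)
      have sp: "space K = UNIV" using K by (auto dest: sets_eq_imp_space_eq)
      have "emeasure (density K (\<lambda>_. ennreal (1 / c))) UNIV = 1"
        using K c sp sets.top[of K]
        by (simp add: emeasure_density_const K.emeasure_eq_measure flip: ennreal_mult)
      then show "real_distribution (density K (\<lambda>_. ennreal (1 / c)))"
        using K sp by (auto simp: real_distribution_def real_distribution_axioms_def intro: prob_spaceI)
      show "char (density K (\<lambda>_. ennreal (1 / c))) t = (1 / c) *\<^sub>R char K t"
        using c unfolding char_def by (subst integral_density) auto
    qed
    have "density M (\<lambda>_. ennreal (1 / c)) = density N (\<lambda>_. ennreal (1 / c))"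
    proof (rule Levy_uniqueness)
      show "char (density M (\<lambda>_. ennreal (1 / c))) = char (density N (\<lambda>_. ennreal (1 / c)))"
        using norm(2)[OF M c_def[symmetric]] norm(2)[OF N c_N[symmetric]] char by auto
    qed (intro norm(1) M N c_def[symmetric] c_N[symmetric])+
    then have "ennreal (1 / c) * emeasure M A = ennreal (1 / c) * emeasure N A" if "A \<in> sets M" for A
      using that sets_eq by (metis emeasure_density_const)
    moreover have "ennreal c * (ennreal (1 / c) * x) = x" for x
      using c by (simp flip: mult.assoc ennreal_mult)
    ultimately show ?thesis using sets_eq by (intro measure_eqI) metis+
  qed
qed

text \<open>
  The weights \<open>1 + cos (f + b)\<close> are nonnegative, so the one-dimensional uniqueness theorem applies
  to the images under \<open>g\<close> of the weighted measures; the values \<open>b = 0, \<pi>, - \<pi>/2, \<pi>/2\<close> recover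
  the character \<open>exp (i f)\<close>.
\<close>

lemma integral_iexp_Int_halfspace_eq:
  fixes \<alpha> \<beta> :: "'a::real_normed_vector measure" and f g :: "'a \<Rightarrow> real"
  assumes fin: "finite_measure \<alpha>" "finite_measure \<beta>"
    and sets: "sets \<alpha> = sets borel" "sets \<beta> = sets borel"
    and C: "C \<in> sets borel"
    and eq: "\<And>f. bounded_linear f \<Longrightarrow>
      (CLINT x|\<alpha>. indicator C x *\<^sub>R iexp (f x)) = (CLINT x|\<beta>. indicator C x *\<^sub>R iexp (f x))"
    and f: "bounded_linear f" and g: "bounded_linear g"
  shows "(CLINT x|\<alpha>. indicator (C \<inter> {x. g x \<le> a}) x *\<^sub>R iexp (f x)) =
         (CLINT x|\<beta>. indicator (C \<inter> {x. g x \<le> a}) x *\<^sub>R iexp (f x))"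
proof -
  define w where "w b x = indicator C x * (1 + cos (f x + b))" for b x
  have w_nonneg: "0 \<le> w b x" for b x
    using cos_ge_minus_one[of "f x + b"]
    by (simp add: w_def indicator_def del: cos_ge_minus_one)
  have w_le: "\<bar>w b x\<bar> \<le> 2" for b x
    using cos_le_one[of "f x + b"] cos_ge_minus_one[of "f x + b"]
    by (simp add: w_def indicator_def del: cos_le_one cos_ge_minus_one)
  define D :: "'a measure \<Rightarrow> real \<Rightarrow> real measure" where "D M b = distr (density M (w b)) borel g" for M b
  define J :: "'a measure \<Rightarrow> real \<Rightarrow> real" where "J M b = (LINT x|M. w b x * indicator {..a} (g x))" for M b
  \<comment> \<open>The second fact reduces \<open>char (D M b)\<close> to integrals of characters
    over \<open>C\<close>, where the hypothesis \<open>eq\<close> applies. The fourth expresses the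
    target by the numbers \<open>J\<close>, which by the third depend on \<open>D M b\<close>
    only.\<close>
  have key: "finite_measure (D M b)"
      "char (D M b) t = (CLINT x|M. indicator C x *\<^sub>R iexp (t * g x))
          + iexp b / 2 * (CLINT x|M. indicator C x *\<^sub>R iexp (f x + t * g x))
          + iexp (- b) / 2 * (CLINT x|M. indicator C x *\<^sub>R iexp (t * g x - f x))"
      "(LINT z|D M b. indicator {..a} z) = J M b"
      "(CLINT x|M. indicator (C \<inter> {x. g x \<le> a}) x *\<^sub>R iexp (f x)) =
        of_real ((J M 0 - J M pi) / 2) + \<i> * of_real ((J M (- pi / 2) - J M (pi / 2)) / 2)"
    if M: "finite_measure M" "sets M = sets borel" for M :: "'a measure" and b t
  proof -
    interpret M: finite_measure M by (rule M)
    note [measurable_cong] = M(2)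
    note [measurable] = borel_measurable_bounded_linear[OF f] borel_measurable_bounded_linear[OF g] C
    have w_meas [measurable]: "w b \<in> borel_measurable M" for b
      unfolding w_def by measurable
    have w_int: "integrable M (w b)" for b
      using w_le by (intro M.integrable_const_bound[where B = 2]) auto
    have "emeasure (density M (w b)) (space M) = ennreal (LINT x|M. w b x)"
      using w_nonneg w_int
      by (simp add: emeasure_density nn_integral_eq_integral cong: nn_integral_cong)
    then have "finite_measure (density M (w b))"
      by (intro finite_measureI) auto
    then show "finite_measure (D M b)"
      unfolding D_def by (rule finite_measure.finite_measure_distr) measurable
    have D_int: "integral\<^sup>L (D M b) h = (LINT x|M. w b x *\<^sub>R h (g x))"
      if [measurable]: "h \<in> borel_measurable borel"
      for h :: "real \<Rightarrow> 'c::{banach, second_countable_topology}"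
      unfolding D_def using w_nonneg
      by (subst integral_distr, measurable, subst integral_density) auto
    show "(LINT z|D M b. indicator {..a} z) = J M b"
      by (subst D_int) (auto simp: J_def)
    have int: "integrable M (\<lambda>x. indicator C x *\<^sub>R iexp (h x))"
      if [measurable]: "h \<in> borel_measurable borel" for h
      by (intro M.integrable_const_bound[where B = 1]) (auto simp: indicator_def)
    have lincomb: "(CLINT x|M. u x + c * v x + d * z x) =
        (CLINT x|M. u x) + c * (CLINT x|M. v x) + d * (CLINT x|M. z x)"
      if "integrable M u" "integrable M v" "integrable M z" for u v z :: "'a \<Rightarrow> complex" and c d
      using that by simp
    have "char (D M b) t = (CLINT x|M. w b x *\<^sub>R iexp (t * g x))"
      unfolding char_def by (rule D_int) measurable
    also have "\<dots> = (CLINT x|M. indicator C x *\<^sub>R iexp (t * g x)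
          + iexp b / 2 * (indicator C x *\<^sub>R iexp (f x + t * g x))
          + iexp (- b) / 2 * (indicator C x *\<^sub>R iexp (t * g x - f x)))"
    proof (rule Bochner_Integration.integral_cong)
      fix x
      have "complex_of_real (1 + cos (f x + b)) = 1 + (iexp (f x + b) + iexp (- (f x + b))) / 2"
        by (simp add: cos_of_real[symmetric] cos_exp_eq algebra_simps del: cos_of_real)
      then have "(1 + cos (f x + b)) *\<^sub>R iexp (t * g x) =
          iexp (t * g x) + iexp b / 2 * iexp (f x + t * g x) + iexp (- b) / 2 * iexp (t * g x - f x)"
        unfolding scaleR_conv_of_real
        by (simp add: algebra_simps add_divide_distrib flip: exp_add)
      then show "w b x *\<^sub>R iexp (t * g x) = indicator C x *\<^sub>R iexp (t * g x)
          + iexp b / 2 * (indicator C x *\<^sub>R iexp (f x + t * g x))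
          + iexp (- b) / 2 * (indicator C x *\<^sub>R iexp (t * g x - f x))"
        by (simp add: w_def indicator_def)
    qed simp
    also have "\<dots> = (CLINT x|M. indicator C x *\<^sub>R iexp (t * g x))
          + iexp b / 2 * (CLINT x|M. indicator C x *\<^sub>R iexp (f x + t * g x))
          + iexp (- b) / 2 * (CLINT x|M. indicator C x *\<^sub>R iexp (t * g x - f x))"
      by (intro lincomb int) measurable
    finally show "char (D M b) t = (CLINT x|M. indicator C x *\<^sub>R iexp (t * g x))
          + iexp b / 2 * (CLINT x|M. indicator C x *\<^sub>R iexp (f x + t * g x))
          + iexp (- b) / 2 * (CLINT x|M. indicator C x *\<^sub>R iexp (t * g x - f x))" .
    let ?j = "\<lambda>b x. w b x * indicator {..a} (g x)"
    have j_int: "integrable M (?j b)" for b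
      using w_le by (intro M.integrable_const_bound[where B = 2]) (auto simp: abs_mult indicator_def)
    \<comment> \<open>On \<open>C\<close>, \<open>w 0 - w pi\<close> is \<open>2 * cos (f x)\<close>
      and \<open>w (- pi / 2) - w (pi / 2)\<close> is \<open>2 * sin (f x)\<close>.\<close>
    have "(CLINT x|M. indicator (C \<inter> {x. g x \<le> a}) x *\<^sub>R iexp (f x)) =
      (CLINT x|M. of_real ((?j 0 x - ?j pi x) / 2) + \<i> * of_real ((?j (- pi / 2) x - ?j (pi / 2) x) / 2))"
      by (intro Bochner_Integration.integral_cong)
         (auto simp: w_def indicator_def complex_eq_iff Re_exp Im_exp cos_add cos_diff algebra_simps)
    also have "\<dots> = of_real (LINT x|M. (?j 0 x - ?j pi x) / 2)
        + \<i> * of_real (LINT x|M. (?j (- pi / 2) x - ?j (pi / 2) x) / 2)"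
      using j_int by (subst Bochner_Integration.integral_add) (auto simp del: of_real_divide of_real_diff)
    also have "\<dots> = of_real ((J M 0 - J M pi) / 2) + \<i> * of_real ((J M (- pi / 2) - J M (pi / 2)) / 2)"
      using j_int by (simp add: J_def)
    finally show "(CLINT x|M. indicator (C \<inter> {x. g x \<le> a}) x *\<^sub>R iexp (f x)) =
        of_real ((J M 0 - J M pi) / 2) + \<i> * of_real ((J M (- pi / 2) - J M (pi / 2)) / 2)" .
  qed
  have lin: "bounded_linear (\<lambda>x. t * g x)" "bounded_linear (\<lambda>x. f x + t * g x)"
    "bounded_linear (\<lambda>x. t * g x - f x)" for t
    using f g by (auto intro!: bounded_linear_add bounded_linear_sub bounded_linear_const_mult)
  have "D \<alpha> b = D \<beta> b" for b
  proof (rule finite_measure_eq_if_char_eq)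
    show "char (D \<alpha> b) = char (D \<beta> b)"
      using eq[OF lin(1)] eq[OF lin(2)] eq[OF lin(3)]
      by (intro ext) (simp add: key(2)[OF fin(1) sets(1)] key(2)[OF fin(2) sets(2)])
  qed (use key(1) fin sets in \<open>auto simp: D_def\<close>)
  then have "J \<alpha> b = J \<beta> b" for b
    using key(3)[OF fin(1) sets(1), of b] key(3)[OF fin(2) sets(2), of b] by metis
  then show ?thesis
    unfolding key(4)[OF fin(1) sets(1)] key(4)[OF fin(2) sets(2)] by simp
qed

text \<open>Induction over cylinder sets shows that all characters have equal integrals over each of
  them; the functional must stay arbitrary, since adding a half-space uses the equality at other
  functionals. The functional \<open>0\<close> then gives equal masses on an intersection-stable
  generator.\<close>

lemma finite_measure_eq_if_characters_eq:
  fixes \<alpha> \<beta> :: "'a::real_normed_vector measure"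
  assumes D: "countable D" "closure D = (UNIV :: 'a set)"
    and fin: "finite_measure \<alpha>" "finite_measure \<beta>"
    and sets: "sets \<alpha> = sets borel" "sets \<beta> = sets borel"
    and eq: "\<And>f. bounded_linear f \<Longrightarrow> (CLINT x|\<alpha>. iexp (f x)) = (CLINT x|\<beta>. iexp (f x))"
  shows "\<alpha> = \<beta>"
proof (rule measure_eqI_generator_eq[OF Int_stable_cylinder_sets])
  interpret A: finite_measure \<alpha> by (rule fin)
  interpret B: finite_measure \<beta> by (rule fin)
  have good: "bounded_linear f \<Longrightarrow>
      (CLINT x|\<alpha>. indicator C x *\<^sub>R iexp (f x)) = (CLINT x|\<beta>. indicator C x *\<^sub>R iexp (f x))"
    if "C \<in> cylinder_sets" for C f
    using that
  proof (induction arbitrary: f)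
    case UNIV
    then show ?case using eq by simp
  next
    case (halfspace C g a)
    then show ?case
      using cylinder_sets_borel[OF halfspace.hyps(1)] fin sets
      by (intro integral_iexp_Int_halfspace_eq) auto
  qed
  show "emeasure \<alpha> C = emeasure \<beta> C" if C: "C \<in> cylinder_sets" for C
  proof -
    have "C \<in> sets \<alpha>" "C \<in> sets \<beta>" using cylinder_sets_borel[OF C] sets by auto
    moreover have "complex_of_real (LINT x|\<alpha>. indicator C x) = complex_of_real (LINT x|\<beta>. indicator C x)"
      using good[OF C bounded_linear_zero]
      by (simp add: scaleR_conv_of_real del: of_real_indicator)
    ultimately show ?thesis
      by (simp add: A.emeasure_eq_measure B.emeasure_eq_measure)
  qed
  show "sets \<alpha> = sigma_sets UNIV cylinder_sets" "sets \<beta> = sigma_sets UNIV cylinder_sets"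
    using sigma_sets_cylinder_sets[OF D] sets by auto
  show "range (\<lambda>_::nat. UNIV) \<subseteq> cylinder_sets" by (auto intro: cylinder_sets.UNIV)
  show "emeasure \<alpha> UNIV \<noteq> \<infinity>" by simp
qed auto

subsection \<open>Rotation invariance\<close>

lemma char_centered_gaussian_real:
  assumes "centered_gaussian_real \<nu>"
  shows "\<exists>\<sigma>. \<forall>t. char \<nu> t = of_real (exp (- ((\<sigma> * t)\<^sup>2) / 2))"
proof -
  obtain \<sigma> where \<sigma>: "0 \<le> \<sigma>" and \<nu>: "\<nu> = (if \<sigma> = 0 then return borel 0
      else density lborel (\<lambda>x. ennreal (normal_density 0 \<sigma> x)))"
    using assms unfolding centered_gaussian_real_def by blast
  show ?thesis
  proof (cases "\<sigma> = 0")
    case True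
    have "char \<nu> t = of_real (exp (- ((0 * t)\<^sup>2) / 2))" for t
      using True by (simp add: \<nu> char_def integral_return)
    then show ?thesis by blast
  next
    case False
    then have pos: "0 < \<sigma>" using \<sigma> by simp
    \<comment> \<open>The substitution of \<open>\<sigma> * x\<close> for \<open>x\<close> turns the
      density into the standard one; its Jacobian is the factor \<open>\<sigma>\<close>.\<close>
    have dens: "\<sigma> * normal_density 0 \<sigma> (0 + \<sigma> * x) = std_normal_density x" for x
      using pos by (simp add: normal_density_def std_normal_density_def real_sqrt_mult power_mult_distrib)
    have "char \<nu> t = of_real (exp (- ((\<sigma> * t)\<^sup>2) / 2))" for t
    proof -
      have "char \<nu> t = (CLINT x|lborel. normal_density 0 \<sigma> x *\<^sub>R iexp (t * x))"
        using False pos unfolding char_def \<nu> by (simp add: integral_density del: of_real_mult)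
      also have "\<dots> = \<bar>\<sigma>\<bar> *\<^sub>R (CLINT x|lborel.
          normal_density 0 \<sigma> (0 + \<sigma> * x) *\<^sub>R iexp (t * (0 + \<sigma> * x)))"
        using False by (rule lborel_integral_real_affine)
      also have "\<dots> = (CLINT x|lborel. \<sigma> *\<^sub>R
          (normal_density 0 \<sigma> (0 + \<sigma> * x) *\<^sub>R iexp (t * (0 + \<sigma> * x))))"
        using pos by (simp only: abs_of_pos integral_scaleR_right)
      also have "\<dots> = (CLINT x|lborel. std_normal_density x *\<^sub>R iexp ((\<sigma> * t) * x))"
        unfolding scaleR_scaleR dens by (simp add: mult_ac)
      also have "\<dots> = char std_normal_distribution (\<sigma> * t)"
        unfolding char_def by (simp add: integral_density del: of_real_mult)
      finally show ?thesis by (simp add: char_std_normal_distribution)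
    qed
    then show ?thesis by blast
  qed
qed

text \<open>One \<open>\<sigma>\<close> serves all \<open>t\<close>: the rotation argument compares
  the values at \<open>cos t\<close>, \<open>sin t\<close> and \<open>1\<close>.\<close>

lemma integral_iexp_centered_gaussian:
  fixes f :: "'a::real_normed_vector \<Rightarrow> real"
  assumes \<mu>: "centered_gaussian_measure \<mu>" and f: "bounded_linear f"
  shows "\<exists>\<sigma>. \<forall>t. (CLINT x|\<mu>. iexp (t * f x)) = of_real (exp (- ((\<sigma> * t)\<^sup>2) / 2))"
proof -
  have [measurable_cong]: "sets \<mu> = sets borel"
    using \<mu> by (simp add: centered_gaussian_measure_def)
  note [measurable] = borel_measurable_bounded_linear[OF f]
  have "centered_gaussian_real (distr \<mu> borel f)"
    using \<mu> f by (simp add: centered_gaussian_measure_def)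
  moreover have "char (distr \<mu> borel f) t = (CLINT x|\<mu>. iexp (t * f x))" for t
    unfolding char_def by (rule integral_distr) measurable
  ultimately show ?thesis using char_centered_gaussian_real by metis
qed

text \<open>For fixed \<open>p\<close> this is an elliptic arc that leaves \<open>fst p\<close> with
  velocity \<open>snd p\<close>; for fixed \<open>t\<close> it is one component of a rotation of the
  pair.\<close>

definition rot :: "real \<Rightarrow> 'a::real_vector \<times> 'a \<Rightarrow> 'a" where
  "rot t p = cos t *\<^sub>R fst p + sin t *\<^sub>R snd p"

lemma rot_0 [simp]: "rot 0 p = fst p"
  by (simp add: rot_def)

lemma continuous_on_rot [continuous_intros]:
  fixes g :: "'b::t2_space \<Rightarrow> 'a::real_normed_vector \<times> 'a"
  assumes "continuous_on S h" "continuous_on S g"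
  shows "continuous_on S (\<lambda>x. rot (h x) (g x))"
  unfolding rot_def by (intro continuous_intros assms)

locale separable_gaussian =
  fixes \<mu> :: "'a::real_normed_vector measure" and D :: "'a set"
  assumes gaussian: "centered_gaussian_measure \<mu>"
    and D: "countable D" "closure D = UNIV"
begin

lemma sets_\<mu> [measurable_cong]: "sets \<mu> = sets borel"
  using gaussian by (simp add: centered_gaussian_measure_def)

lemma space_\<mu> [simp]: "space \<mu> = UNIV"
  using sets_eq_imp_space_eq[OF sets_\<mu>] by simp

sublocale pair_prob_space \<mu> \<mu>
  using gaussian
  by (auto simp: centered_gaussian_measure_def pair_prob_space_def pair_sigma_finite_def
      intro: prob_space_imp_sigma_finite)

lemma D_Times: "countable (D \<times> D)" "closure (D \<times> D) = UNIV"
  using D by (auto simp: closure_Times)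

lemma sets_pair_\<mu>: "sets (\<mu> \<Otimes>\<^sub>M \<mu>) = sets borel"
  using sets_borel_Times_separable[OF D D] sets_pair_measure_cong[OF sets_\<mu> sets_\<mu>] by simp

lemma measurable_rot: "rot t \<in> (\<mu> \<Otimes>\<^sub>M \<mu>) \<rightarrow>\<^sub>M borel"
proof -
  have "rot t \<in> borel_measurable (borel :: ('a \<times> 'a) measure)"
    by (intro borel_measurable_continuous_onI continuous_intros)
  then show ?thesis using measurable_cong_sets[OF sets_pair_\<mu> refl] by blast
qed

text \<open>Needed for Fubini in time and pair together. Continuity gives measurability for the
  Borel sets of the product space, which separability identifies with the product
  sigma-algebra.\<close>

lemma measurable_rot_joint: "(\<lambda>(t, p). rot t p) \<in> (lborel \<Otimes>\<^sub>M (\<mu> \<Otimes>\<^sub>M \<mu>)) \<rightarrow>\<^sub>M borel"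
proof -
  obtain Q :: "real set" where Q: "countable Q" "\<And>X. open X \<Longrightarrow> X \<noteq> {} \<Longrightarrow> \<exists>q\<in>Q. q \<in> X"
    using countable_dense_setE by blast
  have dense: "closure Q = UNIV"
  proof (rule ccontr)
    assume "closure Q \<noteq> UNIV"
    then obtain q where "q \<in> Q" "q \<in> - closure Q" using Q(2)[of "- closure Q"] by auto
    then show False using closure_subset[of Q] by auto
  qed
  have "sets (lborel \<Otimes>\<^sub>M (\<mu> \<Otimes>\<^sub>M \<mu>)) = sets (borel :: (real \<times> 'a \<times> 'a) measure)"
    by (rule trans[OF sets_pair_measure_cong[OF sets_lborel sets_pair_\<mu>]
          sets_borel_Times_separable[OF Q(1) dense D_Times]])
  moreover have "(\<lambda>(t, p). rot t p) \<in> borel_measurable (borel :: (real \<times> 'a \<times> 'a) measure)"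
    unfolding case_prod_beta by (intro borel_measurable_continuous_onI continuous_intros)
  ultimately show ?thesis using measurable_cong_sets[OF _ refl] by blast
qed

text \<open>By Fubini the character of the image factors into Gaussian ones with variances
  \<open>(\<sigma> * cos t)\<^sup>2\<close> and \<open>(\<sigma> * sin t)\<^sup>2\<close>, which add
  up to \<open>\<sigma>\<^sup>2\<close>.\<close>

lemma distr_rot: "distr (\<mu> \<Otimes>\<^sub>M \<mu>) borel (rot t) = \<mu>"
proof (rule finite_measure_eq_if_characters_eq[OF D])
  show "finite_measure (distr (\<mu> \<Otimes>\<^sub>M \<mu>) borel (rot t))"
    using measurable_rot by (intro P.finite_measure_distr)
  show "finite_measure \<mu>" by (rule M1.finite_measure_axioms)
  show "sets (distr (\<mu> \<Otimes>\<^sub>M \<mu>) borel (rot t)) = sets borel" "sets \<mu> = sets borel"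
    by (simp_all add: sets_\<mu>)
  fix f :: "'a \<Rightarrow> real" assume f: "bounded_linear f"
  note [measurable] = borel_measurable_bounded_linear[OF f] measurable_rot
  obtain \<sigma> where \<sigma>: "\<And>t. (CLINT x|\<mu>. iexp (t * f x)) = of_real (exp (- ((\<sigma> * t)\<^sup>2) / 2))"
    using integral_iexp_centered_gaussian[OF gaussian f] by blast
  have "(CLINT x|distr (\<mu> \<Otimes>\<^sub>M \<mu>) borel (rot t). iexp (f x)) = (CLINT p|\<mu> \<Otimes>\<^sub>M \<mu>. iexp (f (rot t p)))"
    by (rule integral_distr) measurable
  also have "\<dots> = (CLINT x|\<mu>. CLINT y|\<mu>. iexp (f (rot t (x, y))))"
    by (rule integral_fst'[symmetric]) (intro P.integrable_const_bound[where B = 1]; measurable; simp)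
  also have "\<dots> = (CLINT x|\<mu>. CLINT y|\<mu>. iexp (cos t * f x) * iexp (sin t * f y))"
  proof -
    have "f (rot t (x, y)) = cos t * f x + sin t * f y" for x y
      using bounded_linear.linear[OF f] by (simp add: rot_def linear_add linear_cmul)
    then show ?thesis by (simp add: ring_distribs exp_add)
  qed
  also have "\<dots> = (CLINT x|\<mu>. iexp (cos t * f x)) * (CLINT y|\<mu>. iexp (sin t * f y))"
    by (simp del: of_real_mult)
  also have "\<dots> = of_real (exp (- ((\<sigma> * cos t)\<^sup>2) / 2)) * of_real (exp (- ((\<sigma> * sin t)\<^sup>2) / 2))"
    unfolding \<sigma> ..
  also have "\<dots> = of_real (exp (- ((\<sigma> * cos t)\<^sup>2) / 2 + - ((\<sigma> * sin t)\<^sup>2) / 2))"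
    by (simp only: exp_add of_real_mult)
  also have "- ((\<sigma> * cos t)\<^sup>2) / 2 + - ((\<sigma> * sin t)\<^sup>2) / 2 = - ((\<sigma> * 1)\<^sup>2) / 2"
    using sin_cos_squared_add[of t]
    by (simp add: power_mult_distrib field_simps flip: distrib_left)
  also have "of_real (exp \<dots>) = (CLINT x|\<mu>. iexp (1 * f x))" by (rule \<sigma>[symmetric])
  finally show "(CLINT x|distr (\<mu> \<Otimes>\<^sub>M \<mu>) borel (rot t). iexp (f x)) = (CLINT x|\<mu>. iexp (f x))"
    by simp
qed

text \<open>At each fixed time \<open>rot t p\<close> has law \<open>\<mu>\<close> and so avoids
  \<open>N\<close> almost surely; Fubini exchanges the two quantifiers.\<close>

lemma AE_rot_notin:
  assumes N: "N \<in> sets borel" "emeasure \<mu> N = 0"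
  shows "AE p in \<mu> \<Otimes>\<^sub>M \<mu>. AE t in lborel. rot t p \<notin> N"
proof -
  interpret L: pair_sigma_finite lborel "\<mu> \<Otimes>\<^sub>M \<mu>" ..
  note [measurable] = measurable_rot_joint N(1)
  have "{x \<in> space (lborel \<Otimes>\<^sub>M (\<mu> \<Otimes>\<^sub>M \<mu>)). (case x of (t, p) \<Rightarrow> rot t p) \<notin> N}
      \<in> sets (lborel \<Otimes>\<^sub>M (\<mu> \<Otimes>\<^sub>M \<mu>))"
    by measurable
  then have meas: "{x \<in> space (lborel \<Otimes>\<^sub>M (\<mu> \<Otimes>\<^sub>M \<mu>)). rot (fst x) (snd x) \<notin> N}
      \<in> sets (lborel \<Otimes>\<^sub>M (\<mu> \<Otimes>\<^sub>M \<mu>))"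
    by (simp add: case_prod_beta)
  have "AE p in \<mu> \<Otimes>\<^sub>M \<mu>. rot t p \<notin> N" for t
  proof -
    have "N \<in> null_sets (distr (\<mu> \<Otimes>\<^sub>M \<mu>) borel (rot t))"
      unfolding distr_rot using N by (simp add: null_sets_def sets_\<mu>)
    then have "AE x in distr (\<mu> \<Otimes>\<^sub>M \<mu>) borel (rot t). x \<notin> N" by (rule AE_not_in)
    then show ?thesis by (rule AE_distrD[OF measurable_rot])
  qed
  then have "AE t in lborel. AE p in \<mu> \<Otimes>\<^sub>M \<mu>. rot t p \<notin> N" by simp
  then show ?thesis using L.AE_commute[OF meas] by simp
qed

text \<open>An almost sure property holds on a dense set of pairs: an open set of pairs contains a
  rectangle around each of its points, and this rectangle has positive product mass.\<close>

lemma AE_ex_open: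
  assumes pos: "\<And>A. open A \<Longrightarrow> A \<noteq> {} \<Longrightarrow> emeasure \<mu> A > 0"
    and Q: "AE p in \<mu> \<Otimes>\<^sub>M \<mu>. Q p" and W: "open W" "w \<in> W"
  shows "\<exists>p\<in>W. Q p"
proof (rule ccontr)
  assume neg: "\<not> (\<exists>p\<in>W. Q p)"
  obtain A B where AB: "open A" "open B" "w \<in> A \<times> B" "A \<times> B \<subseteq> W"
    using W open_prod_elim by metis
  obtain N where N: "N \<in> null_sets (\<mu> \<Otimes>\<^sub>M \<mu>)" "{p \<in> space (\<mu> \<Otimes>\<^sub>M \<mu>). \<not> Q p} \<subseteq> N"
    using Q by (auto simp: eventually_ae_filter)
  have "A \<times> B \<subseteq> N" using AB neg N by (auto simp: space_pair_measure)
  then have "emeasure (\<mu> \<Otimes>\<^sub>M \<mu>) (A \<times> B) \<le> emeasure (\<mu> \<Otimes>\<^sub>M \<mu>) N"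
    using N by (intro emeasure_mono) auto
  then have "emeasure \<mu> A * emeasure \<mu> B = 0"
    using N AB by (simp add: M1.emeasure_pair_measure_Times sets_\<mu> null_setsD1)
  moreover have "0 < emeasure \<mu> A" "0 < emeasure \<mu> B" using AB by (auto intro!: pos)
  ultimately show False by auto
qed

end

subsection \<open>Constancy along arcs\<close>

text \<open>
  A differentiable function maps null sets to null sets, so here the image of the interval is both
  connected and null.
\<close>

lemma differentiable_ae_null_image_const:
  fixes \<phi> :: "real \<Rightarrow> real"
  assumes diff: "\<And>t. t \<in> {a..b} \<Longrightarrow> \<phi> differentiable (at t)" and ab: "a \<le> b"
    and B: "B \<in> null_sets lborel" and ae: "AE t in lborel. t \<in> {a..b} \<longrightarrow> \<phi> t \<in> B"
  shows "\<phi> a = \<phi> b"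
proof -
  obtain N where N: "N \<in> null_sets lborel" "{t. \<not> (t \<in> {a..b} \<longrightarrow> \<phi> t \<in> B)} \<subseteq> N"
    using ae by (auto simp: eventually_ae_filter)
  have null: "S \<in> null_sets lborel \<Longrightarrow> negligible S" for S :: "real set"
    by (simp add: negligible_iff_null_sets null_sets_completionI)
  have "negligible (N \<inter> {a..b})"
    using null[OF N(1)] by (rule negligible_subset) auto
  moreover have "\<phi> differentiable_on (N \<inter> {a..b})"
    using diff by (auto simp: differentiable_on_def intro: differentiable_at_withinI)
  ultimately have "negligible (\<phi> ` (N \<inter> {a..b}))"
    by (intro negligible_differentiable_image_negligible) auto
  then have "negligible (B \<union> \<phi> ` (N \<inter> {a..b}))" using null[OF B] by simp
  \<comment> \<open>Times outside \<open>N\<close> are sent into the null set \<open>B\<close>, and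
    those in \<open>N\<close> have a null image.\<close>
  moreover have "\<phi> ` {a..b} \<subseteq> B \<union> \<phi> ` (N \<inter> {a..b})" using N by auto
  ultimately have image: "negligible (\<phi> ` {a..b})" by (rule negligible_subset)
  have "continuous_on {a..b} \<phi>"
    using diff by (intro differentiable_imp_continuous_on)
      (auto simp: differentiable_on_def intro: differentiable_at_withinI)
  then have "convex (\<phi> ` {a..b})"
    by (metis connected_continuous_image connected_convex_1 connected_Icc)
  then have "closed_segment (\<phi> a) (\<phi> b) \<subseteq> \<phi> ` {a..b}"
    using ab by (intro closed_segment_subset) auto
  then have "negligible (closed_segment (\<phi> a) (\<phi> b))" using image negligible_subset by blast
  then show ?thesis
    using negligible_interval(1)[of "\<phi> a" "\<phi> b"] negligible_interval(1)[of "\<phi> b" "\<phi> a"]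
    by (auto simp: closed_segment_eq_real_ivl box_eq_empty split: if_splits)
qed

lemma has_derivative_rot:
  fixes p :: "'a::real_normed_vector \<times> 'a"
  shows "((\<lambda>t. rot t p) has_derivative (\<lambda>h. h *\<^sub>R (- sin t *\<^sub>R fst p + cos t *\<^sub>R snd p))) (at t)"
  unfolding rot_def has_vector_derivative_def[symmetric]
  by (rule has_vector_derivative_eq_rhs, (rule derivative_intros)+) simp

context separable_gaussian
begin

text \<open>\<open>L y\<close> is the derivative at time \<open>0\<close> of \<open>V\<close> along
  the arc of \<open>(x, y)\<close>. Here \<open>- S\<close> is the null set that contains almost
  every value of \<open>V\<close>.\<close>

lemma derivative_eq_0:
  fixes V :: "'a \<Rightarrow> real"
  assumes pos: "\<And>A. open A \<Longrightarrow> A \<noteq> {} \<Longrightarrow> emeasure \<mu> A > 0"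
    and V: "V \<in> borel_measurable borel"
    and U: "open U" and diff: "\<And>x. x \<in> U \<Longrightarrow> V differentiable (at x)"
    and S: "S \<in> sets borel" "emeasure \<mu> (V -` S) = 0" "- S \<in> null_sets lborel"
    and x: "x \<in> U" and L: "(V has_derivative L) (at x)"
  shows "L y = 0"
proof -
  have "V -` S \<in> sets borel" using measurable_sets[OF V S(1)] by simp
  then have ae: "AE p in \<mu> \<Otimes>\<^sub>M \<mu>. AE t in lborel. V (rot t p) \<notin> S"
    using AE_rot_notin[OF _ S(2)] by simp
  \<comment> \<open>A product neighbourhood of \<open>(0, x, y)\<close> inside \<open>?T\<close>
    yields one time bound \<open>e\<close> for all pairs in \<open>W\<close>.\<close>
  let ?T = "(\<lambda>z. rot (fst z) (snd z)) -` U :: (real \<times> 'a \<times> 'a) set"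
  have "open ?T"
    using U by (intro open_vimage continuous_intros)
  moreover have "(0, x, y) \<in> ?T" using x by simp
  ultimately obtain I W where IW: "open I" "open W" "(0, x, y) \<in> I \<times> W" "I \<times> W \<subseteq> ?T"
    by (rule open_prod_elim)
  then have "0 \<in> I" "(x, y) \<in> W" by auto
  then obtain e where e: "0 < e" "ball 0 e \<subseteq> I" using IW(1) by (meson openE)
  have inU: "rot t p \<in> U" if "\<bar>t\<bar> < e" "p \<in> W" for t p
  proof -
    have "(t, p) \<in> I \<times> W" using that e(2) by auto
    then have "(t, p) \<in> ?T" using IW(4) by blast
    then show ?thesis by simp
  qed
  have diff_rot: "(\<lambda>t. V (rot t p)) differentiable (at t)" if "\<bar>t\<bar> < e" "p \<in> W" for t p
    using differentiable_chain_at[of "\<lambda>t. rot t p" t V] has_derivative_rot[of p t] diff[OF inU[OF that]]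
    by (auto simp: o_def differentiable_def[of "\<lambda>t. rot t p"])
  have const_good: "V (rot t p) = V (rot 0 p)"
    if t: "\<bar>t\<bar> < e" and p: "p \<in> W" and good: "AE t in lborel. V (rot t p) \<notin> S" for t p
  proof -
    \<comment> \<open>Stated for ordered endpoints so that it covers both \<open>[0, t]\<close> and
      \<open>[t, 0]\<close>; \<open>t\<close> may be negative.\<close>
    have ivl: "V (rot a p) = V (rot b p)" if "a \<le> b" "\<bar>a\<bar> < e" "\<bar>b\<bar> < e" for a b
    proof (rule differentiable_ae_null_image_const[OF _ that(1) S(3)])
      show "AE t in lborel. t \<in> {a..b} \<longrightarrow> V (rot t p) \<in> - S"
        using good by (auto elim: eventually_mono)
    qed (use that p in \<open>auto intro!: diff_rot\<close>)
    show ?thesis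
      using ivl[of t 0] ivl[of 0 t] t e(1) by (cases "t \<le> 0") auto
  qed
  have V_cont: "continuous_on U V"
    using diff by (intro differentiable_imp_continuous_on)
      (auto simp: differentiable_on_def intro: differentiable_at_withinI)
  have const: "V (rot t (x, y)) = V (rot 0 (x, y))" if t: "\<bar>t\<bar> < e" for t
  proof (rule ccontr)
    assume ne: "V (rot t (x, y)) \<noteq> V (rot 0 (x, y))"
    have cont: "continuous_on W (\<lambda>p. V (rot s p))" if "\<bar>s\<bar> < e" for s
      by (rule continuous_on_compose2[OF V_cont]) (use inU that in \<open>auto intro!: continuous_intros\<close>)
    let ?g = "\<lambda>p. V (rot t p) - V (rot 0 p)"
    have "continuous_on W ?g"
      using cont[of t] cont[of 0] t e(1) by (intro continuous_on_diff) simp_all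
    \<comment> \<open>Pairs in \<open>W\<close> whose values at times \<open>t\<close> and
      \<open>0\<close> differ form an open set. Containing \<open>(x, y)\<close>, it would also
      contain a pair to which \<open>const_good\<close> applies.\<close>
    then have "open (W \<inter> ?g -` (- {0}))"
      using IW(2) by (intro continuous_open_preimage) auto
    moreover have "(x, y) \<in> W \<inter> ?g -` (- {0})" using ne \<open>(x, y) \<in> W\<close> by simp
    ultimately obtain p where "p \<in> W \<inter> ?g -` (- {0})" "AE t in lborel. V (rot t p) \<notin> S"
      using AE_ex_open[OF pos ae] by blast
    then show False using const_good[OF t, of p] by auto
  qed
  have "((\<lambda>t. V (rot t (x, y))) has_derivative (\<lambda>h. L (h *\<^sub>R (- sin 0 *\<^sub>R x + cos 0 *\<^sub>R y)))) (at 0)"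
    by (rule has_derivative_compose[OF has_derivative_rot[of "(x, y)" 0, simplified fst_conv snd_conv]])
       (use L in simp)
  moreover have "L (h *\<^sub>R y) = L y * h" for h
    using has_derivative_bounded_linear[OF L]
    by (simp add: bounded_linear.linear linear_cmul)
  ultimately have "DERIV (\<lambda>t. V (rot t (x, y))) 0 :> L y"
    unfolding has_field_derivative_def by (simp add: mult.commute[of _ "L y"])
  moreover have "\<forall>s. \<bar>0 - s\<bar> < e \<longrightarrow> V (rot 0 (x, y)) = V (rot s (x, y))"
    using const by simp
  ultimately show ?thesis by (rule DERIV_local_const[OF _ e(1)])
qed

end

section \<open>Mutual singularity would force \<open>V\<close> to be constant on
  \<open>U\<close>\<close>

theorem corollary3p4:
  fixes P :: "'w measure"
    and X :: "'w \<Rightarrow> 'e::banach"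
    and \<mu> :: "'e measure"
    and V :: "'e \<Rightarrow> real"
    and U :: "'e set"
  assumes "prob_space P"
    and "X \<in> P \<rightarrow>\<^sub>M borel"
    and "\<mu> = distr P borel X"
    and "centered_gaussian_measure \<mu>"
    and "\<And>A. open A \<Longrightarrow> A \<noteq> {} \<Longrightarrow> emeasure \<mu> A > 0"
    and "V \<in> borel_measurable borel"
    and "open U" and "connected U"
    and "\<And>x. x \<in> U \<Longrightarrow> V differentiable (at x)"
    and "\<not> V constant_on U"
  shows "\<not> mutually_singular (distr P borel (\<lambda>w. V (X w))) lborel"
proof
  assume "mutually_singular (distr P borel (\<lambda>w. V (X w))) lborel"
  \<comment> \<open>\<open>S\<close> carries Lebesgue measure and is avoided by \<open>V(X)\<close>
    almost surely, so the law of \<open>V(X)\<close> lives on the null set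
    \<open>- S\<close>.\<close>
  then obtain S where S: "S \<in> sets borel" "emeasure (distr P borel (\<lambda>w. V (X w))) S = 0"
    "emeasure lborel (UNIV - S) = 0"
    unfolding mutually_singular_def by auto
  have null: "- S \<in> null_sets lborel"
    using S by (auto simp: null_sets_def Compl_eq_Diff_UNIV)
  have "distr P borel (\<lambda>w. V (X w)) = distr \<mu> borel V"
    using distr_distr[OF assms(6,2)] by (simp add: assms(3) o_def)
  moreover have "V \<in> \<mu> \<rightarrow>\<^sub>M borel" using assms(6) by (simp add: assms(3))
  ultimately have zero: "emeasure \<mu> (V -` S) = 0"
    using S by (simp add: emeasure_distr assms(3))
  have "prob_space \<mu>" "sets \<mu> = sets borel"
    using assms(4) by (auto simp: centered_gaussian_measure_def)
  then obtain D :: "'e set" where "countable D" "closure D = UNIV"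
    using separable_if_full_support[of \<mu>] assms(5) prob_space.finite_measure by metis
  then interpret separable_gaussian \<mu> D
    using assms(4) by unfold_locales
  \<comment> \<open>The derivative vanishes in every direction, so \<open>V\<close> is constant on
    each ball inside \<open>U\<close>; connectedness makes this global.\<close>
  have "V constant_on U"
  proof (rule locally_constant_imp_constant[OF assms(8)])
    fix a assume a: "a \<in> U"
    obtain r where r: "0 < r" "ball a r \<subseteq> U" using assms(7) a by (meson openE)
    have "(V has_derivative (\<lambda>h. 0)) (at x within ball a r)" if x: "x \<in> ball a r" for x
    proof -
      have "x \<in> U" using x r by auto
      then obtain L where L: "(V has_derivative L) (at x)"
        using assms(9) unfolding differentiable_def by blast
      have "L = (\<lambda>h. 0)"
        using derivative_eq_0[OF assms(5,6,7,9) S(1) zero null \<open>x \<in> U\<close> L] by auto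
      then show ?thesis using L has_derivative_at_withinI by blast
    qed
    then obtain c where "\<forall>x\<in>ball a r. V x = c"
      using has_derivative_zero_constant[OF convex_ball] by blast
    then have "\<forall>x\<in>ball a r. V x = V a" using r by simp
    moreover have "openin (top_of_set U) (ball a r)"
      by (rule open_openin_trans[OF assms(7) open_ball r(2)])
    ultimately show "\<exists>T. openin (top_of_set U) T \<and> a \<in> T \<and> (\<forall>x\<in>T. V x = V a)"
      using centre_in_ball[THEN iffD2, OF r(1)] by blast
  qed
  then show False using assms(10) by simp
qed

end
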